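(* Let $m,n\ge 2$, let $A\in\mathbb{R}^{m\times n}$ preserve Chebyshev systems, and let $G_A$ be the sign transition graph of $A$. Let $L\subset\{-1,1\}^n$ be the set of all loop vertices of $G_A$. Then $$\inf\{\|A-uv^T\|_C : u\in\mathbb{R}^m,\ v\in\mathbb{R}^n\}=\min_{t\in L}E(A,t).$$
   Context: A vector is called Chebyshev if all of its components are non-zero; $\mathrm{Ch}_n$ is the set of Chebyshev vectors in $\mathbb{R}^n$. For $v\in\mathrm{Ch}_n$, $\mathcal{S}(v)\in\{-1,1\}^n$ is the vector of signs, $\mathcal{S}(v)_i=\operatorname{sign}(v_i)$. $\|X\|_C=\max_{i,j}|x_{ij}|$ is the Chebyshev norm of a matrix $X$. For $a\in\mathbb{R}^n$ and $v\in\mathrm{Ch}_n$ (any $n\ge 2$), $\mu(a,v)$ is the unique real number with $\|a-\mu(a,v)v\|_\infty=\inf_{t\in\mathbb{R}}\|a-tv\|_\infty$ (it exists and is unique). Denote by $a^i$ the $i$-th row and by $a_j$ the $j$-th column of $A$. For $v\in\mathrm{Ch}_n$, $\phi(A,v)\in\mathbb{R}^m$ is defined by $\phi(A,v)_i=\mu(a^i,v)$; for $u\in\mathrm{Ch}_m$, $\psi(A,u)\in\mathbb{R}^n$ is defined by $\psi(A,u)_j=\mu(a_j,u)$. $A\in\mathbb{R}^{m\times n}$ preserves Chebyshev systems if $\phi(A,v)\in\mathrm{Ch}_m$ for all $v\in\mathrm{Ch}_n$ and $\psi(A,u)\in\mathrm{Ch}_n$ for all $u\in\mathrm{Ch}_m$.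 For such $A$ and $v^{(0)}\in\mathrm{Ch}_n$ the alternating minimization method produces the sequences $u^{(k)}=\phi(A,v^{(k-1)})$, $v^{(k)}=\psi(A,u^{(k)})$, $k=1,2,\dots$. The sequence $\|A-u^{(k)}(v^{(k)})^T\|_C$ is non-increasing, and $E(A,v)$ denotes its limit when $v^{(0)}=v$. Define $\mathcal{T}(q)=\mathcal{S}(\phi(A,q))$ for $q\in\{-1,1\}^n$, $\mathcal{R}(p)=\mathcal{S}(\psi(A,p))$ for $p\in\{-1,1\}^m$, and $\mathcal{V}=\mathcal{R}\circ\mathcal{T}:\{-1,1\}^n\to\{-1,1\}^n$. The sign transition graph $G_A$ is the directed graph with vertex set $\{-1,1\}^n$ and an edge $t_1\to t_2$ if and only if $\mathcal{V}(t_1)=t_2$. A loop vertex is a vertex $t$ with an edge $t\to t$. *)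

theory Defs
  imports "HOL-Analysis.Analysis" "Graph_Theory.Pair_Digraph"
begin

definition Ch :: "(real ^ 'n) set" where
  "Ch = {v. \<forall>i. v $ i \<noteq> 0}"

definition sign_vec :: "real ^ 'n \<Rightarrow> real ^ 'n" where
  "sign_vec v = (\<chi> i. sgn (v $ i))"

definition sign_vectors :: "(real ^ 'n) set" where
  "sign_vectors = {t. \<forall>i. t $ i \<in> {-1, 1}}"

definition cheb_norm :: "real ^ 'n ^ 'm \<Rightarrow> real" where
  "cheb_norm X = Max {\<bar>X $ i $ j\<bar> | i j. True}"

definition outer :: "real ^ 'm \<Rightarrow> real ^ 'n \<Rightarrow> real ^ 'n ^ 'm" where
  "outer u v = (\<chi> i j. u $ i * v $ j)"

text \<open>For \<open>v \<in> Ch\<close> the minimiser exists and is unique; \<open>\<mu>\<close> is only meaningful there.\<close>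

definition mu :: "real ^ 'n \<Rightarrow> real ^ 'n \<Rightarrow> real" where
  "mu a v = (THE t. infnorm (a - t *\<^sub>R v) = (INF s. infnorm (a - s *\<^sub>R v)))"

definition phi :: "real ^ 'n ^ 'm \<Rightarrow> real ^ 'n \<Rightarrow> real ^ 'm" where
  "phi A v = (\<chi> i. mu (row i A) v)"

definition psi :: "real ^ 'n ^ 'm \<Rightarrow> real ^ 'm \<Rightarrow> real ^ 'n" where
  "psi A u = (\<chi> j. mu (column j A) u)"

definition preserves_chebyshev_systems :: "real ^ 'n ^ 'm \<Rightarrow> bool" where
  "preserves_chebyshev_systems A \<longleftrightarrow>
     (\<forall>v\<in>Ch. phi A v \<in> Ch) \<and> (\<forall>u\<in>Ch. psi A u \<in> Ch)"

text \<open>The iterates \<open>u\<^sup>k = \<phi>(A, v\<^sup>k\<^sup>-\<^sup>1)\<close>, \<open>v\<^sup>k = \<psi>(A, u\<^sup>k)\<close> for \<open>k \<ge> 1\<close>, started at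
  \<open>v\<^sup>0 = v\<close>. There is no \<open>u\<^sup>0\<close>: the value \<open>am_u A v 0\<close> is junk and is not used.\<close>

primrec am_v :: "real ^ 'n ^ 'm \<Rightarrow> real ^ 'n \<Rightarrow> nat \<Rightarrow> real ^ 'n" where
  "am_v A v 0 = v"
| "am_v A v (Suc k) = psi A (phi A (am_v A v k))"

definition am_u :: "real ^ 'n ^ 'm \<Rightarrow> real ^ 'n \<Rightarrow> nat \<Rightarrow> real ^ 'm" where
  "am_u A v k = phi A (am_v A v (k - 1))"

definition limit_error :: "real ^ 'n ^ 'm \<Rightarrow> real ^ 'n \<Rightarrow> real" where
  "limit_error A v = lim (\<lambda>k. cheb_norm (A - outer (am_u A v (Suc k)) (am_v A v (Suc k))))"

definition sign_T :: "real ^ 'n ^ 'm \<Rightarrow> real ^ 'n \<Rightarrow> real ^ 'm" where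
  "sign_T A q = sign_vec (phi A q)"

definition sign_R :: "real ^ 'n ^ 'm \<Rightarrow> real ^ 'm \<Rightarrow> real ^ 'n" where
  "sign_R A p = sign_vec (psi A p)"

definition sign_V :: "real ^ 'n ^ 'm \<Rightarrow> real ^ 'n \<Rightarrow> real ^ 'n" where
  "sign_V A = sign_R A \<circ> sign_T A"

definition sign_transition_graph :: "real ^ 'n ^ 'm \<Rightarrow> (real ^ 'n) pair_pre_digraph" where
  "sign_transition_graph A =
     \<lparr> pverts = sign_vectors,
       parcs = {(t\<^sub>1, t\<^sub>2). t\<^sub>1 \<in> sign_vectors \<and> t\<^sub>2 \<in> sign_vectors \<and> sign_V A t\<^sub>1 = t\<^sub>2} \<rparr>"

definition loop_vertices :: "'a pair_pre_digraph \<Rightarrow> 'a set" where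
  "loop_vertices G = {t \<in> pverts G. (t, t) \<in> parcs G}"

end

theory Submission imports Defs begin

text \<open>Write \<open>v\<^sub>k\<close> for the iterates of the method and \<open>u\<^sub>k = phi A v\<^sub>k\<close>. Two facts carry the
  proof: the signs of the iterates settle at a loop vertex, and the method started at a loop
  vertex reaches the smallest error possible for its signs.

  Signs settle. If \<open>mu a v\<close> vanishes for no Chebyshev vector \<open>v\<close>, then \<open>a\<close> has a single
  entry \<open>a $ j\<close> of largest modulus, and \<open>mu a v\<close> has the sign of \<open>a $ j * v $ j\<close>
  (\<open>sgn_mu\<close>, \<open>unique_argmax_if_mu_nonzero\<close>). So a sweep of the method sends the sign of
  coordinate \<open>\<sigma> j\<close>, up to a fixed factor, to coordinate \<open>j\<close>, where \<open>\<sigma>\<close> goes from a column to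
  the row of its largest entry and on to the column of the largest entry of that row. Along
  \<open>\<sigma>\<close> the maximum of the column increases strictly unless \<open>\<sigma> j = j\<close>, and in that case
  the sign in coordinate \<open>j\<close> is reproduced, since both factors are the sign of the same entry.
  Hence every sign vector reaches a loop after finitely many sweeps
  (\<open>am_v_reaches_loop_signs\<close>).

  Optimality in a sign class. Let \<open>v\<^sub>k\<close> be iterates whose signs stay the same. By
  homogeneity they may be rescaled; after one sweep the moduli of the rescaled coordinates are
  bounded below, because \<open>\<bar>mu a u\<bar>\<close> is comparable with the inverse of the norm of \<open>u\<close>
  (\<open>mu_upper_bound\<close>, \<open>mu_lower_bound\<close>). A limit point \<open>x\<close> of the rescaled iterates
  is then a Chebyshev vector with the same signs, and by continuity the error stays constant,
  equal to the limit error \<open>E\<close>, when the method is started at \<open>x\<close>. With a constant error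
  the columns that attain it form a decreasing sequence of sets, on which the iterates do not
  move. Call a residual positive if it has the sign of the product \<open>u $ i * v $ j\<close> that
  approximates the entry. Once the sequence of sets stabilises, the entries that attain the error
  contain a closed path that alternates between rows and columns and between positive and
  negative residuals. A pair of the same signs with error below \<open>E\<close> would have products of
  larger modulus at the positive residuals and of smaller modulus at the negative ones, which
  is contradictory along a closed path
  (\<open>stationary_error_optimal_in_sign_class\<close>).

  Both facts give the theorem. Any pair is approximated by one with Chebyshev \<open>v\<close>; running
  the method from \<open>v\<close> until the signs form a loop vertex \<open>t\<close> does not increase the error,
  and the limit error of \<open>t\<close> is at most the error reached. Conversely a limit error is a
  limit of values of the norm being minimised.\<close>

section \<open>Best multiples of a vector in the maximum norm\<close>

lemma infnorm_le_cart_iff: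
  fixes x :: "real ^ 'n"
  shows "infnorm x \<le> d \<longleftrightarrow> (\<forall>i. \<bar>x $ i\<bar> \<le> d)"
proof -
  have "bdd_above (range (\<lambda>i. \<bar>x $ i\<bar>))" by (intro bdd_above_finite) auto
  then show ?thesis by (simp add: infnorm_cart full_SetCompr_eq cSup_le_iff)
qed

lemma infnorm_attained_cart:
  fixes x :: "real ^ 'n"
  obtains i where "\<bar>x $ i\<bar> = infnorm x"
proof -
  have "infnorm x = Max (range (\<lambda>i. \<bar>x $ i\<bar>))"
    by (simp add: infnorm_cart full_SetCompr_eq cSup_eq_Max)
  moreover have "Max (range (\<lambda>i. \<bar>x $ i\<bar>)) \<in> range (\<lambda>i. \<bar>x $ i\<bar>)"
    by (rule Max_in) auto
  ultimately have "infnorm x \<in> range (\<lambda>i. \<bar>x $ i\<bar>)" by simp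
  then show ?thesis using that by auto
qed

lemma infnorm_eq_cartI:
  fixes x :: "real ^ 'n"
  assumes "infnorm x \<le> d" "\<bar>x $ i\<bar> = d" shows "infnorm x = d"
  using assms component_le_infnorm_cart[of x i] by simp

definition best_multiple :: "real ^ 'n \<Rightarrow> real ^ 'n \<Rightarrow> real \<Rightarrow> bool" where
  "best_multiple a v t \<longleftrightarrow> (\<forall>s. infnorm (a - t *\<^sub>R v) \<le> infnorm (a - s *\<^sub>R v))"

lemma best_multiple_exists:
  fixes a v :: "real ^ 'n"
  assumes "v \<noteq> 0"
  shows "\<exists>t. best_multiple a v t"
proof -
  define R where "R = 2 * infnorm a / infnorm v"
  have pos: "infnorm v > 0" using assms by (simp add: infnorm_pos_lt)
  have R0: "R \<ge> 0" unfolding R_def using pos by (simp add: infnorm_pos_le)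
  have "continuous_on {-R..R} (\<lambda>s. infnorm (a - s *\<^sub>R v))"
    by (intro continuous_intros)
  then obtain t where t: "\<And>s. s \<in> {-R..R} \<Longrightarrow> infnorm (a - t *\<^sub>R v) \<le> infnorm (a - s *\<^sub>R v)"
    using continuous_attains_inf[of "{-R..R}" "\<lambda>s. infnorm (a - s *\<^sub>R v)"] R0 by force
  have "infnorm (a - t *\<^sub>R v) \<le> infnorm (a - s *\<^sub>R v)" for s
  proof (cases "s \<in> {-R..R}")
    case False
    then have "R \<le> \<bar>s\<bar>" by auto
    then have "\<bar>s\<bar> * infnorm v \<ge> 2 * infnorm a"
      using pos by (simp add: R_def field_simps)
    moreover have "infnorm (s *\<^sub>R v) \<le> infnorm (a - s *\<^sub>R v) + infnorm a"
      using infnorm_triangle[of "a - s *\<^sub>R v" "-a"] by (simp add: infnorm_neg)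
    ultimately have "infnorm a \<le> infnorm (a - s *\<^sub>R v)" by (simp add: infnorm_mul)
    then show ?thesis using t[of 0] R0 by simp
  qed (use t in auto)
  then show ?thesis unfolding best_multiple_def by blast
qed

text \<open>At the midpoint of two minimisers some residual has modulus at least the minimum. It is the mean
  of two residuals of modulus at most the minimum, so these coincide; as no coordinate of
  \<open>v\<close> vanishes, so do the minimisers.\<close>

lemma best_multiple_unique:
  fixes a v :: "real ^ 'n"
  assumes v: "v \<in> Ch" and t: "best_multiple a v t" and s: "infnorm (a - s *\<^sub>R v) \<le> infnorm (a - t *\<^sub>R v)"
  shows "s = t"
proof (rule ccontr)
  assume ne: "s \<noteq> t"
  let ?d = "infnorm (a - t *\<^sub>R v)" and ?r = "(s + t) / 2"
  obtain i where i: "\<bar>(a - ?r *\<^sub>R v) $ i\<bar> = infnorm (a - ?r *\<^sub>R v)"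
    by (rule infnorm_attained_cart)
  have mid: "?d \<le> \<bar>a $ i - ?r * v $ i\<bar>" using t i by (simp add: best_multiple_def)
  have "\<bar>a $ i - t * v $ i\<bar> \<le> ?d" "\<bar>a $ i - s * v $ i\<bar> \<le> ?d"
    using component_le_infnorm_cart[of "a - t *\<^sub>R v" i] component_le_infnorm_cart[of "a - s *\<^sub>R v" i] s
    by auto
  moreover have "2 * \<bar>a $ i - ?r * v $ i\<bar> = \<bar>(a $ i - t * v $ i) + (a $ i - s * v $ i)\<bar>"
    by (simp add: field_simps)
  ultimately have "a $ i - t * v $ i = a $ i - s * v $ i" using mid by (smt (verit))
  then show False using v ne by (simp add: Ch_def)
qed

lemma mu_best_multiple:
  fixes a v :: "real ^ 'n"
  assumes v: "v \<in> Ch" shows "best_multiple a v (mu a v)"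
proof -
  have "v \<noteq> 0" using v by (auto simp: Ch_def)
  then obtain t where t: "best_multiple a v t" using best_multiple_exists by blast
  have inf: "(INF s. infnorm (a - s *\<^sub>R v)) = infnorm (a - t *\<^sub>R v)"
    by (rule cInf_eq_minimum) (use t in \<open>auto simp: best_multiple_def\<close>)
  have "mu a v = t"
    unfolding mu_def inf using best_multiple_unique[OF v t] by (intro the_equality) auto
  then show ?thesis using t by simp
qed

lemma mu_le: "v \<in> Ch \<Longrightarrow> infnorm (a - mu a v *\<^sub>R v) \<le> infnorm (a - s *\<^sub>R v)"
  using mu_best_multiple[of v a] unfolding best_multiple_def by blast

lemma mu_eqI:
  "v \<in> Ch \<Longrightarrow> infnorm (a - s *\<^sub>R v) \<le> infnorm (a - mu a v *\<^sub>R v) \<Longrightarrow> mu a v = s"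
  using best_multiple_unique[OF _ mu_best_multiple] by metis

lemma mu_eq_if_best: "v \<in> Ch \<Longrightarrow> best_multiple a v t \<Longrightarrow> mu a v = t"
  by (rule mu_eqI) (auto simp: best_multiple_def)

lemma Ch_scaleR: "v \<in> Ch \<Longrightarrow> c \<noteq> 0 \<Longrightarrow> c *\<^sub>R v \<in> Ch"
  by (simp add: Ch_def)

lemma mu_scaleR:
  assumes "v \<in> Ch" "c \<noteq> 0" shows "mu a (c *\<^sub>R v) = mu a v / c"
proof (rule mu_eq_if_best)
  show "c *\<^sub>R v \<in> Ch" using assms by (rule Ch_scaleR)
  show "best_multiple a (c *\<^sub>R v) (mu a v / c)"
    using mu_le[OF assms(1), of a] assms(2) by (auto simp: best_multiple_def)
qed

text \<open>If all residuals, oriented by the signs of \<open>v\<close>, stayed below the minimal error, a slightly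
  smaller multiple would still do: it raises every oriented residual, but by little. This
  contradicts uniqueness.\<close>

lemma mu_alternance_pos:
  fixes a v :: "real ^ 'n"
  assumes v: "v \<in> Ch"
  obtains i where "sgn (v $ i) * (a $ i - mu a v * v $ i) = infnorm (a - mu a v *\<^sub>R v)"
proof (rule ccontr)
  define t where "t = mu a v"
  define d where "d = infnorm (a - t *\<^sub>R v)"
  define res where "res = (\<lambda>s i. sgn (v $ i) * (a $ i - s * v $ i))"
  assume "\<not> thesis"
  with that have ne: "res t i \<noteq> d" for i
    unfolding t_def d_def res_def by blast
  have abs_res: "\<bar>res s i\<bar> = \<bar>a $ i - s * v $ i\<bar>" for s i
    using v by (simp add: res_def abs_mult abs_sgn_eq Ch_def)
  have le: "\<bar>res t i\<bar> \<le> d" for i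
    using component_le_infnorm_cart[of "a - t *\<^sub>R v" i] by (simp add: abs_res d_def)
  have lt: "res t i < d" for i
    using le[of i] ne[of i] by linarith
  have lim: "((\<lambda>s. res s i) \<longlongrightarrow> res t i) (at_left t)" for i
    unfolding res_def by (intro tendsto_intros)
  have "\<forall>\<^sub>F s in at_left t. \<forall>i. res s i < d"
    using order_tendstoD(2)[OF lim lt] by (intro eventually_all_finite) auto
  then have "\<forall>\<^sub>F s in at_left t. s < t \<and> (\<forall>i. res s i < d)"
    by (intro eventually_conj) (auto simp: eventually_at_left_field intro: lt_ex)
  then obtain s where s: "s < t" "\<And>i. res s i < d"
    using eventually_happens[of _ "at_left t"] trivial_limit_at_left_real by blast
  have "res s i \<ge> res t i" for i
  proof -
    have "res s i = res t i + (t - s) * \<bar>v $ i\<bar>"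
      by (simp add: res_def abs_sgn algebra_simps)
    then show ?thesis using s(1) by simp
  qed
  then have "\<bar>res s i\<bar> \<le> d" for i using s(2)[of i] le[of i] by (smt (verit))
  then have "infnorm (a - s *\<^sub>R v) \<le> d" by (simp add: infnorm_le_cart_iff abs_res)
  then have "t = s" using mu_eqI[OF v, of a s] by (simp add: d_def t_def)
  with s(1) show False by simp
qed

lemma mu_alternance_neg:
  fixes a v :: "real ^ 'n"
  assumes v: "v \<in> Ch"
  obtains i where "sgn (v $ i) * (a $ i - mu a v * v $ i) = - infnorm (a - mu a v *\<^sub>R v)"
proof -
  have "- v \<in> Ch" "mu a (- v) = - mu a v"
    using Ch_scaleR[OF v, of "-1"] mu_scaleR[OF v, of "-1" a] by simp_all
  then obtain i where "sgn ((- v) $ i) * (a $ i - mu a v * v $ i) = infnorm (a - mu a v *\<^sub>R v)"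
    using mu_alternance_pos[of "- v" a] by auto
  then show thesis by (intro that[of i]) (simp add: sgn_minus)
qed

text \<open>The same with residuals oriented by the signs of the approximation \<open>mu a v *\<^sub>R v\<close>, the form
  in which residuals of a rank-one approximation can be compared between rows and columns.\<close>

lemma mu_alternance:
  fixes a v :: "real ^ 'n"
  assumes v: "v \<in> Ch" and nz: "mu a v \<noteq> 0" and e: "e \<in> {-1, 1}"
  obtains i where "sgn (mu a v * v $ i) * (a $ i - mu a v * v $ i) = e * infnorm (a - mu a v *\<^sub>R v)"
proof -
  define f where "f = sgn (mu a v)"
  have f: "f = 1 \<or> f = -1" using nz by (simp add: f_def sgn_if)
  then have fe: "f * e = 1 \<or> f * e = -1" using e by auto
  obtain i where
    "sgn (v $ i) * (a $ i - mu a v * v $ i) = (f * e) * infnorm (a - mu a v *\<^sub>R v)"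
  proof (cases "f * e = 1")
    case True
    then show ?thesis using mu_alternance_pos[OF v, of a] that by (metis mult_1)
  next
    case False
    with fe show ?thesis
      using mu_alternance_neg[OF v, of a] that by (metis mult_minus1)
  qed
  then have "f * (sgn (v $ i) * (a $ i - mu a v * v $ i)) = (f * f) * e * infnorm (a - mu a v *\<^sub>R v)"
    by simp
  then show ?thesis
    using f by (intro that[of i]) (auto simp: sgn_mult mult.assoc f_def[symmetric])
qed

text \<open>A move away from the minimiser in either direction enlarges one of the two alternating
  residuals at the rate \<open>\<bar>v $ i\<bar>\<close>. This turns uniqueness into the quantitative form from which
  continuity of \<open>mu\<close> follows.\<close>

lemma mu_strong_unicity:
  fixes a v :: "real ^ 'n"
  assumes v: "v \<in> Ch" and m: "\<And>i. m \<le> \<bar>v $ i\<bar>"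
  shows "infnorm (a - mu a v *\<^sub>R v) + \<bar>s - mu a v\<bar> * m \<le> infnorm (a - s *\<^sub>R v)"
proof -
  define t where "t = mu a v"
  obtain e :: real where e: "e = 1 \<or> e = -1" "\<bar>s - t\<bar> = e * (t - s)"
    using that[of 1] that[of "-1"] by (cases "s \<le> t") auto
  obtain i where i: "sgn (v $ i) * (a $ i - t * v $ i) = e * infnorm (a - t *\<^sub>R v)"
  proof (cases "e = 1")
    case True
    then show ?thesis using mu_alternance_pos[OF v, of a] that unfolding t_def by (metis mult_1)
  next
    case False
    with e(1) show ?thesis
      using mu_alternance_neg[OF v, of a] that unfolding t_def by (metis mult_minus1)
  qed
  have sq: "e * e = 1" using e(1) by auto
  have "e * (sgn (v $ i) * (a $ i - s * v $ i))
      = e * (sgn (v $ i) * (a $ i - t * v $ i)) + e * (t - s) * \<bar>v $ i\<bar>"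
    by (simp add: abs_sgn algebra_simps)
  also have "\<dots> = infnorm (a - t *\<^sub>R v) + \<bar>s - t\<bar> * \<bar>v $ i\<bar>"
    unfolding i e(2) using sq by (simp flip: mult.assoc)
  also have "\<dots> \<ge> infnorm (a - t *\<^sub>R v) + \<bar>s - t\<bar> * m"
    using m[of i] by (simp add: mult_left_mono)
  finally have "infnorm (a - t *\<^sub>R v) + \<bar>s - t\<bar> * m \<le> e * (sgn (v $ i) * (a $ i - s * v $ i))" .
  also have "\<dots> \<le> \<bar>a $ i - s * v $ i\<bar>"
    using e(1) by (auto simp: sgn_if)
  also have "\<dots> \<le> infnorm (a - s *\<^sub>R v)"
    using component_le_infnorm_cart[of "a - s *\<^sub>R v" i] by simp
  finally show ?thesis by (simp add: t_def)
qed

lemma mu_upper_bound: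
  fixes a v :: "real ^ 'n"
  assumes "v \<in> Ch" shows "\<bar>mu a v\<bar> * infnorm v \<le> 2 * infnorm a"
proof -
  have "\<bar>mu a v\<bar> * infnorm v \<le> infnorm (a - mu a v *\<^sub>R v) + infnorm a"
    using infnorm_triangle[of "a - mu a v *\<^sub>R v" "-a"] by (simp add: infnorm_neg infnorm_mul)
  with mu_le[OF assms, of a 0] show ?thesis by simp
qed

text \<open>Replacing \<open>w k\<close> by \<open>v\<close> changes the error of a multiple \<open>s\<close> by at most
  \<open>\<bar>s\<bar> * infnorm (w k - v)\<close>, so the best multiple for \<open>w k\<close> is nearly best for \<open>v\<close>. Strong unicity
  at \<open>v\<close> converts this into closeness of the multiples.\<close>

lemma mu_tendsto:
  fixes a v :: "real ^ 'n"
  assumes v: "v \<in> Ch" and w: "\<And>k. w k \<in> Ch" and lim: "w \<longlonglongrightarrow> v"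
  shows "(\<lambda>k. mu a (w k)) \<longlonglongrightarrow> mu a v"
proof -
  define m where "m = Min (range (\<lambda>i. \<bar>v $ i\<bar>))"
  have m: "m \<le> \<bar>v $ i\<bar>" for i unfolding m_def by (rule Min_le) auto
  have "m \<in> range (\<lambda>i. \<bar>v $ i\<bar>)" unfolding m_def by (rule Min_in) auto
  then have mpos: "m > 0" using v by (auto simp: Ch_def)
  have vpos: "infnorm v > 0" using v by (auto simp: Ch_def infnorm_pos_lt)
  have wpos: "infnorm (w k) > 0" for k using w[of k] by (auto simp: Ch_def infnorm_pos_lt)
  define B where "B = (\<lambda>k. (2 * infnorm a / infnorm (w k) + \<bar>mu a v\<bar>) * infnorm (w k - v) / m)"
  have "B \<longlonglongrightarrow> (2 * infnorm a / infnorm v + \<bar>mu a v\<bar>) * infnorm (v - v) / m"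
    unfolding B_def using vpos mpos by (intro tendsto_intros tendsto_infnorm lim) auto
  then have B0: "B \<longlonglongrightarrow> 0" by (simp add: infnorm_0)
  have "\<bar>mu a (w k) - mu a v\<bar> \<le> B k" for k
  proof -
    let ?s = "mu a (w k)" and ?t = "mu a v"
    have "infnorm (a - ?s *\<^sub>R v) \<le> infnorm (a - ?s *\<^sub>R w k) + \<bar>?s\<bar> * infnorm (w k - v)"
      using infnorm_triangle[of "a - ?s *\<^sub>R w k" "?s *\<^sub>R (w k - v)"]
      unfolding infnorm_mul by (simp add: scaleR_diff_right)
    moreover have "infnorm (a - ?t *\<^sub>R w k) \<le> infnorm (a - ?t *\<^sub>R v) + \<bar>?t\<bar> * infnorm (w k - v)"
      using infnorm_triangle[of "a - ?t *\<^sub>R v" "?t *\<^sub>R (v - w k)"] infnorm_sub[of v "w k"]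
      unfolding infnorm_mul by (simp add: scaleR_diff_right)
    ultimately have "\<bar>?s - ?t\<bar> * m \<le> (\<bar>?s\<bar> + \<bar>?t\<bar>) * infnorm (w k - v)"
      using mu_strong_unicity[OF v m, of a ?s] mu_le[OF w[of k], of a ?t] by (simp add: algebra_simps)
    also have "\<dots> \<le> (2 * infnorm a / infnorm (w k) + \<bar>?t\<bar>) * infnorm (w k - v)"
      using mu_upper_bound[OF w[of k], of a] wpos[of k]
      by (intro mult_right_mono add_right_mono) (auto simp: field_simps infnorm_pos_le)
    finally show ?thesis unfolding B_def using mpos by (simp add: field_simps)
  qed
  then have "(\<lambda>k. mu a (w k) - mu a v) \<longlonglongrightarrow> 0"
    by (intro Lim_null_comparison[OF _ B0]) auto
  then show ?thesis by (simp add: LIM_zero_iff)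
qed

text \<open>The error of the best multiple is at most that of the multiple \<open>0\<close>, namely \<open>\<bar>a $ j\<bar>\<close>. At
  coordinate \<open>j\<close> itself this forces \<open>mu a v * v $ j\<close> to point in the direction of \<open>a $ j\<close>.\<close>

lemma sgn_mu:
  fixes a v :: "real ^ 'n"
  assumes v: "v \<in> Ch" and nz: "mu a v \<noteq> 0" and j: "\<bar>a $ j\<bar> = infnorm a"
  shows "sgn (mu a v) = sgn (a $ j) * sgn (v $ j)"
proof -
  have "\<bar>a $ j - mu a v * v $ j\<bar> \<le> \<bar>a $ j\<bar>"
    using mu_le[OF v, of a 0] component_le_infnorm_cart[of "a - mu a v *\<^sub>R v" j] j by simp
  moreover have "mu a v * v $ j \<noteq> 0" using nz v by (simp add: Ch_def)
  ultimately have "sgn (mu a v * v $ j) = sgn (a $ j)"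
    by (auto simp: sgn_if)
  then have "sgn (a $ j) = sgn (mu a v) * sgn (v $ j)" by (simp add: sgn_mult)
  moreover have "sgn (v $ j) * sgn (v $ j) = 1" using v by (simp add: Ch_def sgn_if)
  ultimately show ?thesis by simp
qed

text \<open>If two coordinates attained the maximum, signs of \<open>v\<close> could be chosen so that a move to
  either side of \<open>0\<close> makes one of the two residuals larger, and \<open>mu a v\<close> would be \<open>0\<close>.\<close>

lemma unique_argmax_if_mu_nonzero:
  fixes a :: "real ^ 'n"
  assumes nz: "\<And>v. v \<in> Ch \<Longrightarrow> mu a v \<noteq> 0"
    and j: "\<bar>a $ j\<bar> = infnorm a" and k: "\<bar>a $ k\<bar> = infnorm a"
  shows "j = k"
proof (rule ccontr)
  assume "j \<noteq> k"
  \<comment> \<open>A positive multiple of this vector moves away from \<open>a\<close> at \<open>k\<close>, a negative one at \<open>j\<close>.\<close>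
  define v :: "real ^ 'n" where
    "v = (\<chi> i. if i = k then (if a $ k \<ge> 0 then -1 else 1) else if a $ i \<ge> 0 then 1 else -1)"
  have v: "v \<in> Ch" by (simp add: Ch_def v_def)
  have "infnorm (a - 0 *\<^sub>R v) \<le> infnorm (a - s *\<^sub>R v)" for s
  proof (cases "s \<ge> 0")
    case True
    then have "\<bar>a $ k\<bar> \<le> \<bar>(a - s *\<^sub>R v) $ k\<bar>" by (simp add: v_def)
    then show ?thesis using component_le_infnorm_cart[of "a - s *\<^sub>R v" k] k by simp
  next
    case False
    then have "\<bar>a $ j\<bar> \<le> \<bar>(a - s *\<^sub>R v) $ j\<bar>" using \<open>j \<noteq> k\<close> by (simp add: v_def)
    then show ?thesis using component_le_infnorm_cart[of "a - s *\<^sub>R v" j] j by simp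
  qed
  then have "mu a v = 0" using v by (intro mu_eq_if_best) (auto simp: best_multiple_def)
  with nz[OF v] show False by simp
qed

text \<open>By alternance the maximal residual also occurs at a coordinate \<open>k\<close> other than the unique
  coordinate \<open>j\<close> where \<open>\<bar>a $ j\<bar>\<close> is largest. To bring the residual at \<open>j\<close> down to the one at \<open>k\<close>,
  the product \<open>mu a v *\<^sub>R v\<close> has to bridge half of the gap between the largest modulus and the
  others. This bound keeps the rescaled iterates away from the coordinate hyperplanes.\<close>

lemma mu_lower_bound:
  fixes a :: "real ^ 'n"
  assumes card: "CARD('n) \<ge> 2" and nz: "\<And>v. v \<in> Ch \<Longrightarrow> mu a v \<noteq> 0"
  obtains g where "g > 0" "\<And>v. v \<in> Ch \<Longrightarrow> g \<le> \<bar>mu a v\<bar> * infnorm v"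
proof -
  obtain j where j: "\<bar>a $ j\<bar> = infnorm a" by (rule infnorm_attained_cart)
  define G where "G = (\<lambda>k. infnorm a - \<bar>a $ k\<bar>) ` (UNIV - {j})"
  have "UNIV - {j} \<noteq> {}"
  proof
    assume "UNIV - {j} = {}"
    then have "(UNIV :: 'n set) = {j}" by auto
    then have "CARD('n) = card {j}" by metis
    with card show False by simp
  qed
  then have G: "finite G" "G \<noteq> {}" by (auto simp: G_def)
  have "x > 0" if "x \<in> G" for x
  proof -
    from that obtain k where k: "k \<noteq> j" "x = infnorm a - \<bar>a $ k\<bar>" by (auto simp: G_def)
    then have "\<bar>a $ k\<bar> \<noteq> infnorm a" using unique_argmax_if_mu_nonzero[OF nz j] by blast
    with k component_le_infnorm_cart[of a k] show ?thesis by simp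
  qed
  then have "Min G > 0" using Min_in[OF G] by blast
  show ?thesis
  proof (rule that[of "Min G / 2"])
    show "Min G / 2 > 0" using \<open>Min G > 0\<close> by simp
  next
    fix v :: "real ^ 'n" assume v: "v \<in> Ch"
    define t where "t = mu a v"
    let ?d = "infnorm (a - t *\<^sub>R v)"
    obtain p where p: "sgn (v $ p) * (a $ p - t * v $ p) = ?d"
      using mu_alternance_pos[OF v, of a] unfolding t_def .
    obtain q where q: "sgn (v $ q) * (a $ q - t * v $ q) = - ?d"
      using mu_alternance_neg[OF v, of a] unfolding t_def .
    obtain k where k: "k \<noteq> j" "\<bar>a $ k - t * v $ k\<bar> = ?d"
    proof (cases "p = j \<and> q = j")
      case True
      with p q have "?d = 0" by simp
      obtain k where "k \<noteq> j" using \<open>UNIV - {j} \<noteq> {}\<close> by auto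
      then show ?thesis
        using that \<open>?d = 0\<close> component_le_infnorm_cart[of "a - t *\<^sub>R v" k] by simp
    next
      case False
      have "\<bar>a $ i - t * v $ i\<bar> = \<bar>sgn (v $ i) * (a $ i - t * v $ i)\<bar>" for i
        using v by (simp add: Ch_def abs_mult abs_sgn_eq)
      then have "\<bar>a $ p - t * v $ p\<bar> = ?d" "\<bar>a $ q - t * v $ q\<bar> = ?d"
        using p q infnorm_pos_le[of "a - t *\<^sub>R v"] by simp_all
      then show ?thesis using that False by blast
    qed
    have "\<bar>t * v $ i\<bar> \<le> \<bar>t\<bar> * infnorm v" for i
      by (simp add: abs_mult component_le_infnorm_cart mult_left_mono)
    from this[of j] this[of k] have "infnorm a - \<bar>a $ k\<bar> \<le> 2 * (\<bar>t\<bar> * infnorm v)"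
      using k(2) component_le_infnorm_cart[of "a - t *\<^sub>R v" j, simplified] j by linarith
    moreover have "Min G \<le> infnorm a - \<bar>a $ k\<bar>"
      using G k(1) by (auto simp: G_def)
    ultimately show "Min G / 2 \<le> \<bar>mu a v\<bar> * infnorm v" by (simp add: t_def)
  qed
qed

section \<open>Rank-one errors and the sweeps of the method\<close>

lemma cheb_norm_Max: "cheb_norm X = Max (range (\<lambda>(i, j). \<bar>X $ i $ j\<bar>))"
proof -
  have "{\<bar>X $ i $ j\<bar> | i j. True} = range (\<lambda>(i, j). \<bar>X $ i $ j\<bar>)" by auto
  then show ?thesis by (simp add: cheb_norm_def)
qed

lemma cheb_norm_le_iff: "cheb_norm X \<le> d \<longleftrightarrow> (\<forall>i j. \<bar>X $ i $ j\<bar> \<le> d)"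
  by (simp add: cheb_norm_Max)

lemma cheb_norm_attained: obtains i j where "\<bar>X $ i $ j\<bar> = cheb_norm X"
proof -
  have "cheb_norm X \<in> range (\<lambda>(i, j). \<bar>X $ i $ j\<bar>)"
    unfolding cheb_norm_Max by (rule Max_in) auto
  then show ?thesis using that by auto
qed

lemma cheb_norm_nonneg: "0 \<le> cheb_norm X"
  using cheb_norm_le_iff[of X "cheb_norm X"] by (meson abs_ge_zero order_refl order_trans)

lemma cheb_norm_le_add_norm: "cheb_norm X \<le> cheb_norm Y + norm (X - Y)"
  unfolding cheb_norm_le_iff
proof (intro allI)
  fix i j
  have "\<bar>X $ i $ j - Y $ i $ j\<bar> \<le> norm (X - Y)"
    using Finite_Cartesian_Product.norm_nth_le[of "X - Y" i] Finite_Cartesian_Product.norm_nth_le[of "(X - Y) $ i" j] by simp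
  moreover have "\<bar>Y $ i $ j\<bar> \<le> cheb_norm Y" using cheb_norm_le_iff[of Y "cheb_norm Y"] by simp
  ultimately show "\<bar>X $ i $ j\<bar> \<le> cheb_norm Y + norm (X - Y)" by linarith
qed

lemma tendsto_cheb_norm:
  assumes "(f \<longlongrightarrow> X) F" shows "((\<lambda>x. cheb_norm (f x)) \<longlongrightarrow> cheb_norm X) F"
proof -
  have "\<bar>cheb_norm (f x) - cheb_norm X\<bar> \<le> norm (f x - X)" for x
    using cheb_norm_le_add_norm[of "f x" X] cheb_norm_le_add_norm[of X "f x"]
    by (simp add: norm_minus_commute)
  then have "\<forall>\<^sub>F x in F. norm (cheb_norm (f x) - cheb_norm X) \<le> norm (f x - X)"
    by simp
  moreover have "((\<lambda>x. norm (f x - X)) \<longlongrightarrow> 0) F"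
    using assms by (simp add: LIM_zero_iff tendsto_norm_zero)
  ultimately have "((\<lambda>x. cheb_norm (f x) - cheb_norm X) \<longlongrightarrow> 0) F"
    by (rule Lim_null_comparison)
  then show ?thesis by (simp add: LIM_zero_iff)
qed

definition rank1_error :: "real ^ 'n ^ 'm \<Rightarrow> real ^ 'm \<Rightarrow> real ^ 'n \<Rightarrow> real" where
  "rank1_error A u v = cheb_norm (A - outer u v)"

lemma rank1_error_le_iff: "rank1_error A u v \<le> d \<longleftrightarrow> (\<forall>i j. \<bar>A $ i $ j - u $ i * v $ j\<bar> \<le> d)"
  by (simp add: rank1_error_def cheb_norm_le_iff outer_def)

lemma rank1_error_attained:
  obtains i j where "\<bar>A $ i $ j - u $ i * v $ j\<bar> = rank1_error A u v"
  using cheb_norm_attained[of "A - outer u v"] by (auto simp: rank1_error_def outer_def)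

lemma entry_le_rank1_error: "\<bar>A $ i $ j - u $ i * v $ j\<bar> \<le> rank1_error A u v"
  using rank1_error_le_iff by blast

lemma rank1_error_le_iff_rows:
  "rank1_error A u v \<le> d \<longleftrightarrow> (\<forall>i. infnorm (row i A - u $ i *\<^sub>R v) \<le> d)"
  by (simp add: rank1_error_le_iff infnorm_le_cart_iff row_def)

lemma rank1_error_le_iff_columns:
  "rank1_error A u v \<le> d \<longleftrightarrow> (\<forall>j. infnorm (column j A - v $ j *\<^sub>R u) \<le> d)"
  unfolding rank1_error_le_iff infnorm_le_cart_iff column_def
  by (subst all_comm) (simp add: mult.commute)

lemma row_error_le: "infnorm (row i A - u $ i *\<^sub>R v) \<le> rank1_error A u v"
  using rank1_error_le_iff_rows by blast

lemma column_error_le: "infnorm (column j A - v $ j *\<^sub>R u) \<le> rank1_error A u v"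
  using rank1_error_le_iff_columns by blast

lemma rank1_error_phi_le: "v \<in> Ch \<Longrightarrow> rank1_error A (phi A v) v \<le> rank1_error A u v"
  unfolding rank1_error_le_iff_rows phi_def
  by (auto intro: order_trans[OF mu_le row_error_le])

lemma rank1_error_psi_le: "u \<in> Ch \<Longrightarrow> rank1_error A u (psi A u) \<le> rank1_error A u v"
  unfolding rank1_error_le_iff_columns psi_def
  by (auto intro: order_trans[OF mu_le column_error_le])

lemma phi_unique_row:
  "v \<in> Ch \<Longrightarrow> infnorm (row i A - t *\<^sub>R v) \<le> infnorm (row i A - phi A v $ i *\<^sub>R v) \<Longrightarrow> phi A v $ i = t"
  unfolding phi_def by (auto intro: mu_eqI)

lemma psi_unique_column:
  "u \<in> Ch \<Longrightarrow> infnorm (column j A - t *\<^sub>R u) \<le> infnorm (column j A - psi A u $ j *\<^sub>R u)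
    \<Longrightarrow> psi A u $ j = t"
  unfolding psi_def by (auto intro: mu_eqI)

lemma rank1_error_scaleR: "c \<noteq> 0 \<Longrightarrow> rank1_error A ((1 / c) *\<^sub>R u) (c *\<^sub>R v) = rank1_error A u v"
  by (simp add: rank1_error_def outer_def)

lemma tendsto_rank1_error:
  assumes "(f \<longlongrightarrow> u) F" "(g \<longlongrightarrow> v) F"
  shows "((\<lambda>x. rank1_error A (f x) (g x)) \<longlongrightarrow> rank1_error A u v) F"
  unfolding rank1_error_def outer_def
  by (intro tendsto_cheb_norm tendsto_diff tendsto_const vec_tendstoI)
    (auto intro!: tendsto_mult tendsto_vec_nth assms)

lemma phi_scaleR: "v \<in> Ch \<Longrightarrow> c \<noteq> 0 \<Longrightarrow> phi A (c *\<^sub>R v) = (1 / c) *\<^sub>R phi A v"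
  by (simp add: phi_def mu_scaleR vec_eq_iff)

lemma psi_scaleR: "u \<in> Ch \<Longrightarrow> c \<noteq> 0 \<Longrightarrow> psi A (c *\<^sub>R u) = (1 / c) *\<^sub>R psi A u"
  by (simp add: psi_def mu_scaleR vec_eq_iff)

lemma tendsto_phi: "v \<in> Ch \<Longrightarrow> (\<And>k. w k \<in> Ch) \<Longrightarrow> w \<longlonglongrightarrow> v \<Longrightarrow> (\<lambda>k. phi A (w k)) \<longlonglongrightarrow> phi A v"
  unfolding phi_def by (intro vec_tendstoI) (simp add: mu_tendsto)

lemma tendsto_psi: "u \<in> Ch \<Longrightarrow> (\<And>k. w k \<in> Ch) \<Longrightarrow> w \<longlonglongrightarrow> u \<Longrightarrow> (\<lambda>k. psi A (w k)) \<longlonglongrightarrow> psi A u"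
  unfolding psi_def by (intro vec_tendstoI) (simp add: mu_tendsto)

lemma sign_vec_nth_eqD: "sign_vec v = sign_vec w \<Longrightarrow> sgn (v $ i) = sgn (w $ i)"
  by (auto simp: sign_vec_def vec_eq_iff)

lemma Ch_cong_sign_vec: "sign_vec v = sign_vec w \<Longrightarrow> v \<in> Ch \<Longrightarrow> w \<in> Ch"
  by (simp add: Ch_def) (metis sgn_0_0 sign_vec_nth_eqD)

lemma am_v_add: "am_v A v (k + j) = am_v A (am_v A v k) j"
  by (induction j) auto

text \<open>The error after one sweep of the method from \<open>v\<close>, that is, the term of the sequence
  defining \<open>limit_error\<close> in which \<open>v\<close> is the previous iterate.\<close>

definition am_error :: "real ^ 'n ^ 'm \<Rightarrow> real ^ 'n \<Rightarrow> real" where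
  "am_error A v = rank1_error A (phi A v) (psi A (phi A v))"

lemma limit_error_eq: "limit_error A v = lim (\<lambda>k. am_error A (am_v A v k))"
  by (simp add: limit_error_def am_error_def rank1_error_def am_u_def)

locale chebyshev_preserving =
  fixes A :: "real ^ 'n ^ 'm"
  assumes pres: "preserves_chebyshev_systems A"
begin

lemma phi_Ch: "v \<in> Ch \<Longrightarrow> phi A v \<in> Ch" and psi_Ch: "u \<in> Ch \<Longrightarrow> psi A u \<in> Ch"
  using pres by (auto simp: preserves_chebyshev_systems_def)

lemma mu_row_nonzero: "v \<in> Ch \<Longrightarrow> mu (row i A) v \<noteq> 0"
  using phi_Ch[of v] by (auto simp: phi_def Ch_def)

lemma mu_column_nonzero: "u \<in> Ch \<Longrightarrow> mu (column j A) u \<noteq> 0"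
  using psi_Ch[of u] by (auto simp: psi_def Ch_def)

lemma am_v_Ch: "v \<in> Ch \<Longrightarrow> am_v A v k \<in> Ch"
  by (induction k) (auto intro: phi_Ch psi_Ch)

lemma am_v_scaleR:
  assumes "v \<in> Ch" "c \<noteq> 0" shows "am_v A (c *\<^sub>R v) k = c *\<^sub>R am_v A v k"
  by (induction k) (use assms in \<open>auto simp: phi_scaleR psi_scaleR am_v_Ch phi_Ch simp del: inverse_eq_divide\<close>)

text \<open>A sweep sends \<open>c *\<^sub>R v\<close> to the pair scaled by \<open>1 / c\<close> and \<open>c\<close>, whose outer product is the same.
  Iterates may therefore be rescaled at will when their errors are studied.\<close>

lemma am_error_scaleR:
  assumes "v \<in> Ch" "c \<noteq> 0" shows "am_error A (c *\<^sub>R v) = am_error A v"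
  using assms rank1_error_scaleR[of c A "phi A v" "psi A (phi A v)"]
  by (simp add: am_error_def phi_scaleR psi_scaleR phi_Ch)

lemma tendsto_am_v:
  assumes v: "v \<in> Ch" and w: "\<And>k. w k \<in> Ch" and lim: "w \<longlonglongrightarrow> v"
  shows "(\<lambda>k. am_v A (w k) j) \<longlonglongrightarrow> am_v A v j"
  by (induction j) (use assms in \<open>auto intro!: tendsto_phi tendsto_psi phi_Ch psi_Ch am_v_Ch\<close>)

lemma tendsto_am_error:
  assumes "v \<in> Ch" "\<And>k. w k \<in> Ch" "w \<longlonglongrightarrow> v"
  shows "(\<lambda>k. am_error A (w k)) \<longlonglongrightarrow> am_error A v"
  unfolding am_error_def
  by (intro tendsto_rank1_error) (use assms in \<open>auto intro!: tendsto_phi tendsto_psi phi_Ch\<close>)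

text \<open>Each half of a sweep minimises the error in one of the two vectors. Besides monotonicity this
  shows that, when two successive errors agree, the intermediate error agrees with them.\<close>

lemma am_error_Suc_sandwich:
  assumes "v \<in> Ch"
  shows "am_error A (am_v A v (Suc k)) \<le> rank1_error A (phi A (am_v A v (Suc k))) (am_v A v (Suc k))"
    and "rank1_error A (phi A (am_v A v (Suc k))) (am_v A v (Suc k)) \<le> am_error A (am_v A v k)"
  using assms am_v_Ch[of v "Suc k"] unfolding am_error_def
  by (auto intro!: rank1_error_psi_le rank1_error_phi_le phi_Ch psi_Ch am_v_Ch)

lemma decseq_am_error: "v \<in> Ch \<Longrightarrow> decseq (\<lambda>k. am_error A (am_v A v k))"
  unfolding decseq_Suc_iff using am_error_Suc_sandwich order_trans by blast

lemma am_error_tendsto_limit_error: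
  assumes "v \<in> Ch" shows "(\<lambda>k. am_error A (am_v A v k)) \<longlonglongrightarrow> limit_error A v"
proof -
  have "\<bar>am_error A w\<bar> = am_error A w" for w
    by (simp add: am_error_def rank1_error_def cheb_norm_nonneg)
  then have "Bseq (\<lambda>k. am_error A (am_v A v k))"
    using decseqD[OF decseq_am_error[OF assms], of 0]
    by (intro BseqI'[where K = "am_error A (am_v A v 0)"]) simp
  then have "convergent (\<lambda>k. am_error A (am_v A v k))"
    using decseq_am_error[OF assms] by (intro Bseq_monoseq_convergent) (auto simp: monoseq_iff)
  then show ?thesis by (simp add: limit_error_eq convergent_LIMSEQ_iff)
qed

section \<open>A constant error is optimal for its signs\<close>

text \<open>Here the closed alternating path is replaced by an extremal choice. Along a constant error the
  critical columns \<open>crit k\<close>, which attain the error, decrease with \<open>k\<close>, and the iterates are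
  unchanged there, because the old and the new value are both best. When \<open>crit (Suc k) = crit k\<close>,
  take \<open>j\<close> in it with the largest ratio \<open>\<bar>y $ j\<bar> / \<bar>w $ j\<bar>\<close>. Relative to the signs of the products
  \<open>U $ i * y $ j\<close>, column \<open>j\<close> has the residual \<open>E\<close> in some row \<open>i\<close>, and row \<open>i\<close> is then critical
  and has the residual \<open>- E\<close> in some critical column \<open>j'\<close>. For a pair \<open>u\<close>, \<open>w\<close>
  with smaller error these residuals force the ratio at \<open>j\<close> to lie below \<open>\<bar>u $ i\<bar> / \<bar>U $ i\<bar>\<close> and the ratio at \<open>j'\<close> above it, against the choice of \<open>j\<close>.\<close>

lemma stationary_error_optimal_in_sign_class:
  assumes x: "x \<in> Ch" and E: "\<And>k. am_error A (am_v A x k) = E"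
    and sw: "\<And>k. sign_vec (am_v A x k) = sign_vec w"
    and su: "\<And>k. sign_vec (phi A (am_v A x k)) = sign_vec u"
  shows "E \<le> rank1_error A u w"
proof (rule ccontr)
  assume "\<not> E \<le> rank1_error A u w"
  then have better: "\<bar>A $ i $ j - u $ i * w $ j\<bar> < E" for i j
    using entry_le_rank1_error[of A i j u w] by linarith
  define y where "y = am_v A x"
  define U where "U = (\<lambda>k. phi A (y k))"
  have y_Suc: "y (Suc k) = psi A (U k)" for k by (simp add: y_def U_def)
  have yCh: "y k \<in> Ch" and UCh: "U k \<in> Ch" for k
    using x by (auto simp: y_def U_def intro: am_v_Ch phi_Ch)
  have wCh: "w \<in> Ch" and uCh: "u \<in> Ch"
    using Ch_cong_sign_vec[OF sw[of 0] am_v_Ch[OF x]] Ch_cong_sign_vec[OF su[of 0]] UCh[of 0]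
    by (auto simp: U_def y_def)
  have err1: "rank1_error A (U k) (y (Suc k)) = E" for k
    using E[of k] by (simp add: am_error_def U_def y_def)
  have err2: "rank1_error A (U (Suc k)) (y (Suc k)) = E" for k
    using am_error_Suc_sandwich[OF x, of k] E[of k] E[of "Suc k"] by (simp add: U_def y_def)
  have sg: "sgn (U k $ i * y l $ j) = sgn (u $ i * w $ j)" for k l i j
    using sign_vec_nth_eqD[OF sw[of l], of j] sign_vec_nth_eqD[OF su[of k], of i]
    by (simp add: sgn_mult U_def y_def)
  define crit where
    "crit = (\<lambda>k. {j. infnorm (column j A - y (Suc k) $ j *\<^sub>R U k) = E})"
  have critI: "j \<in> crit k" if "\<bar>A $ i $ j - U k $ i * y (Suc k) $ j\<bar> = E" for i j k
    unfolding crit_def mem_Collect_eq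
    by (rule infnorm_eq_cartI[where i = i])
      (use column_error_le[of j A "y (Suc k)" "U k"] err1[of k] that in \<open>auto simp: column_def mult.commute\<close>)
  have crit_nonempty: "crit k \<noteq> {}" for k
  proof -
    obtain i j where "\<bar>A $ i $ j - U k $ i * y (Suc k) $ j\<bar> = E"
      using rank1_error_attained[of A "U k" "y (Suc k)"] unfolding err1 .
    then show ?thesis using critI by blast
  qed
  \<comment> \<open>In a critical column the old value is as good as the new one, hence equal to it.\<close>
  have y_crit: "y (Suc (Suc k)) $ j = y (Suc k) $ j" if "j \<in> crit (Suc k)" for k j
    unfolding y_Suc[of "Suc k"]
    by (rule psi_unique_column[OF UCh])
      (use column_error_le[of j A "y (Suc k)" "U (Suc k)"] err2[of k] that in
        \<open>auto simp: crit_def y_Suc[of "Suc k"]\<close>)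
  have row_crit: "infnorm (row i A - U (Suc k) $ i *\<^sub>R y (Suc k)) = E"
    if "\<bar>A $ i $ j - U (Suc k) $ i * y (Suc k) $ j\<bar> = E" for i j k
    by (rule infnorm_eq_cartI[where i = j])
      (use row_error_le[of i A "U (Suc k)" "y (Suc k)"] err2[of k] that in \<open>auto simp: row_def\<close>)
  \<comment> \<open>In a critical row of the new \<open>U\<close> the old coefficient was already best.\<close>
  have U_crit: "U (Suc k) $ i = U k $ i"
    if "\<bar>A $ i $ j - U (Suc k) $ i * y (Suc k) $ j\<bar> = E" for i j k
    unfolding U_def
    by (rule phi_unique_row[OF yCh])
      (use row_error_le[of i A "U k" "y (Suc k)"] err1[of k] row_crit[OF that] in \<open>auto simp: U_def\<close>)
  have crit_back: "j \<in> crit k" if "\<bar>A $ i $ j - U (Suc k) $ i * y (Suc k) $ j\<bar> = E" for i j k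
    using critI[of i j k] U_crit[OF that] that by simp
  have alt_col: "\<exists>i. sgn (U k $ i * y (Suc k) $ j) * (A $ i $ j - U k $ i * y (Suc k) $ j) = E"
    if "j \<in> crit k" for k j
    using mu_alternance[OF UCh[of k] mu_column_nonzero[OF UCh[of k]], of 1 j] that
    by (simp add: crit_def y_Suc psi_def column_def mult.commute) metis
  have alt_row: "\<exists>j. sgn (U k $ i * y k $ j) * (A $ i $ j - U k $ i * y k $ j) = - E"
    if "infnorm (row i A - U k $ i *\<^sub>R y k) = E" for k i
    using mu_alternance[OF yCh[of k] mu_row_nonzero[OF yCh[of k]], of "-1" i] that
    by (simp add: U_def phi_def row_def) metis
  have absE: "\<bar>z\<bar> = E" if "sgn (U k $ i * y l $ j) * z = e * E" "e = 1 \<or> e = -1" for k l i j z e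
  proof -
    have "\<bar>sgn (U k $ i * y l $ j)\<bar> = 1" using yCh[of l] UCh[of k] by (simp add: Ch_def abs_sgn_eq)
    moreover have "E > 0" using better[of undefined undefined] by linarith
    ultimately show ?thesis using arg_cong[OF that(1), of abs] that(2) by (auto simp: abs_mult)
  qed
  have crit_mono: "crit (Suc k) \<subseteq> crit k" for k
  proof
    fix j assume j: "j \<in> crit (Suc k)"
    obtain i where "sgn (U (Suc k) $ i * y (Suc (Suc k)) $ j) *
        (A $ i $ j - U (Suc k) $ i * y (Suc (Suc k)) $ j) = E"
      using alt_col[OF j] by blast
    then have "\<bar>A $ i $ j - U (Suc k) $ i * y (Suc k) $ j\<bar> = E"
      using absE[of "Suc k" i "Suc (Suc k)" j _ 1] y_crit[OF j] by auto
    then show "j \<in> crit k" by (rule crit_back)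
  qed
  have "\<exists>k. crit (Suc k) = crit k"
  proof (rule ccontr)
    assume "\<nexists>k. crit (Suc k) = crit k"
    then have "card (crit (Suc k)) < card (crit k)" for k
      using crit_mono[of k] by (intro psubset_card_mono) auto
    then have "\<exists>f. \<forall>k. (f (Suc k), f k) \<in> less_than"
      by (intro exI[of _ "\<lambda>k. card (crit k)"]) simp
    then show False using wf_less_than unfolding wf_iff_no_infinite_down_chain by blast
  qed
  then obtain k where k: "crit (Suc k) = crit k" by blast
  define r where "r = (\<lambda>j. \<bar>y (Suc k) $ j\<bar> / \<bar>w $ j\<bar>)"
  have "Max (r ` crit k) \<in> r ` crit k" using crit_nonempty[of k] by (intro Max_in) auto
  then obtain j where j: "j \<in> crit k" and "r j = Max (r ` crit k)" by auto
  then have jmax: "r j' \<le> r j" if "j' \<in> crit k" for j' using that by simp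
  have yj: "y (Suc (Suc k)) $ j = y (Suc k) $ j" using y_crit j k by simp
  obtain i where i: "sgn (U (Suc k) $ i * y (Suc k) $ j) *
      (A $ i $ j - U (Suc k) $ i * y (Suc k) $ j) = E"
    using alt_col[of j "Suc k"] j k yj by auto
  have "\<bar>A $ i $ j - U (Suc k) $ i * y (Suc k) $ j\<bar> = E"
    using absE[of "Suc k" i "Suc k" j _ 1] i by auto
  then obtain j' where j': "sgn (U (Suc k) $ i * y (Suc k) $ j') *
      (A $ i $ j' - U (Suc k) $ i * y (Suc k) $ j') = - E"
    using alt_row[OF row_crit] by blast
  have "j' \<in> crit k" by (rule crit_back[OF absE[of "Suc k" i "Suc k" j' _ "-1"]]) (use j' in auto)
  let ?a = "\<bar>U (Suc k) $ i\<bar>" and ?b = "\<bar>u $ i\<bar>"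
  \<comment> \<open>With the common sign of \<open>u $ i * w $ l\<close> factored out, both errors compare moduli only.\<close>
  have residual: "sgn (U (Suc k) $ i * y (Suc k) $ l) * (A $ i $ l - U (Suc k) $ i * y (Suc k) $ l)
      = sgn (u $ i * w $ l) * A $ i $ l - ?a * \<bar>y (Suc k) $ l\<bar>" for l
    unfolding sg[of "Suc k" i "Suc k" l, symmetric]
    by (simp add: right_diff_distrib flip: abs_mult) (simp add: abs_sgn mult.commute)
  have near: "\<bar>sgn (u $ i * w $ l) * A $ i $ l - ?b * \<bar>w $ l\<bar>\<bar> < E" for l
  proof -
    have "sgn (u $ i * w $ l) * A $ i $ l - ?b * \<bar>w $ l\<bar>
        = sgn (u $ i * w $ l) * (A $ i $ l - u $ i * w $ l)"
      by (simp add: right_diff_distrib flip: abs_mult) (simp add: abs_sgn mult.commute)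
    also have "\<bar>\<dots>\<bar> \<le> \<bar>A $ i $ l - u $ i * w $ l\<bar>" by (simp add: abs_mult abs_sgn_eq)
    finally show ?thesis using better[of i l] by linarith
  qed
  have pos: "?a > 0" "\<bar>w $ l\<bar> > 0" for l using UCh wCh by (auto simp: Ch_def)
  have "?a * \<bar>y (Suc k) $ j\<bar> < ?b * \<bar>w $ j\<bar>" using i near[of j] unfolding residual by linarith
  then have "r j < ?b / ?a" using pos by (simp add: r_def field_simps)
  moreover have "?a * \<bar>y (Suc k) $ j'\<bar> > ?b * \<bar>w $ j'\<bar>"
    using j' near[of j'] unfolding residual by linarith
  then have "?b / ?a < r j'" using pos by (simp add: r_def field_simps)
  ultimately show False using jmax[OF \<open>j' \<in> crit k\<close>] by linarith
qed

end

section \<open>Dynamics of the signs\<close>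

lemma sgn_mu_cong:
  fixes a :: "real ^ 'n"
  assumes "v \<in> Ch" "w \<in> Ch" "mu a v \<noteq> 0" "mu a w \<noteq> 0" "sign_vec v = sign_vec w"
  shows "sgn (mu a v) = sgn (mu a w)"
proof -
  obtain j where "\<bar>a $ j\<bar> = infnorm a" by (rule infnorm_attained_cart)
  then show ?thesis
    using assms sgn_mu[of v a j] sgn_mu[of w a j] sign_vec_nth_eqD[OF assms(5), of j] by simp
qed

lemma sign_vec_idem [simp]: "sign_vec (sign_vec v) = sign_vec v"
  by (simp add: sign_vec_def)

lemma sign_vec_Ch: "v \<in> Ch \<Longrightarrow> sign_vec v \<in> Ch"
  by (simp add: Ch_def sign_vec_def sgn_zero_iff)

lemma sign_vec_in_sign_vectors: "v \<in> Ch \<Longrightarrow> sign_vec v \<in> sign_vectors"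
  by (simp add: Ch_def sign_vec_def sign_vectors_def sgn_if)

lemma sign_vectors_subset_Ch: "(sign_vectors :: (real ^ 'n) set) \<subseteq> Ch"
proof
  fix t :: "real ^ 'n" assume "t \<in> sign_vectors"
  then have "t $ i = -1 \<or> t $ i = 1" for i by (auto simp: sign_vectors_def)
  then have "t $ i \<noteq> 0" for i by (metis zero_neq_neg_one zero_neq_one)
  then show "t \<in> Ch" by (simp add: Ch_def)
qed

lemma finite_sign_vectors: "finite (sign_vectors :: (real ^ 'n) set)"
proof (rule finite_subset)
  show "sign_vectors \<subseteq> vec_lambda ` (PiE UNIV (\<lambda>_ :: 'n. {-1, 1 :: real}))"
  proof
    fix t :: "real ^ 'n" assume "t \<in> sign_vectors"
    then have "vec_nth t \<in> PiE UNIV (\<lambda>_. {-1, 1})" by (auto simp: sign_vectors_def)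
    then show "t \<in> vec_lambda ` (PiE UNIV (\<lambda>_. {-1, 1}))" by (metis image_eqI vec_nth_inverse)
  qed
qed (auto intro!: finite_PiE)

context chebyshev_preserving begin

lemma sign_vec_phi_cong:
  assumes "v \<in> Ch" "w \<in> Ch" "sign_vec v = sign_vec w"
  shows "sign_vec (phi A v) = sign_vec (phi A w)"
proof -
  have "sgn (mu (row k A) v) = sgn (mu (row k A) w)" for k
    using assms by (intro sgn_mu_cong mu_row_nonzero)
  then show ?thesis by (simp add: sign_vec_def phi_def)
qed

lemma sign_vec_psi_cong:
  assumes "u \<in> Ch" "w \<in> Ch" "sign_vec u = sign_vec w"
  shows "sign_vec (psi A u) = sign_vec (psi A w)"
proof -
  have "sgn (mu (column k A) u) = sgn (mu (column k A) w)" for k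
    using assms by (intro sgn_mu_cong mu_column_nonzero)
  then show ?thesis by (simp add: sign_vec_def psi_def)
qed

lemma sign_V_sign_vec:
  assumes "v \<in> Ch" shows "sign_V A (sign_vec v) = sign_vec (psi A (phi A v))"
proof -
  have "sign_vec (phi A (sign_vec v)) = sign_vec (phi A v)"
    using assms by (intro sign_vec_phi_cong) (auto intro: sign_vec_Ch)
  then show ?thesis
    using assms unfolding sign_V_def sign_R_def sign_T_def comp_def
    by (auto intro!: sign_vec_psi_cong sign_vec_Ch phi_Ch)
qed

lemma sign_vec_am_v_Suc:
  "v \<in> Ch \<Longrightarrow> sign_vec (am_v A v (Suc k)) = sign_V A (sign_vec (am_v A v k))"
  by (simp add: sign_V_sign_vec am_v_Ch)

lemma loop_vertices_eq:
  "loop_vertices (sign_transition_graph A) = {t \<in> sign_vectors. sign_V A t = t}"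
  by (auto simp: loop_vertices_def sign_transition_graph_def)

text \<open>The sign of coordinate \<open>j\<close> after a sweep is a fixed factor times the sign of coordinate \<open>l\<close>
  before it, where \<open>A $ i $ j\<close> is the largest entry of column \<open>j\<close> and \<open>A $ i $ l\<close> that of row
  \<open>i\<close>. Either \<open>l = j\<close> and the factor is the square of a sign, or column \<open>l\<close> has a larger maximum
  than column \<open>j\<close>. The induction therefore runs over the number of columns with larger
  maximum.\<close>

lemma am_v_sign_eventually_constant:
  assumes v: "v \<in> Ch"
  shows "\<forall>\<^sub>F k in sequentially. sgn (am_v A v (Suc k) $ j) = sgn (am_v A v k $ j)"
proof (induction j rule: measure_induct_rule[where
      f = "\<lambda>j. card {l. infnorm (column j A) < infnorm (column l A)}"])
  case (less j)
  obtain i where i: "\<bar>column j A $ i\<bar> = infnorm (column j A)" by (rule infnorm_attained_cart)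
  obtain l where l: "\<bar>row i A $ l\<bar> = infnorm (row i A)" by (rule infnorm_attained_cart)
  have step: "sgn (am_v A v (Suc k) $ j) = sgn (A $ i $ j) * sgn (A $ i $ l) * sgn (am_v A v k $ l)" for k
  proof -
    have y: "am_v A v k \<in> Ch" and U: "phi A (am_v A v k) \<in> Ch" using v by (auto intro: am_v_Ch phi_Ch)
    show ?thesis
      using sgn_mu[OF U mu_column_nonzero[OF U] i] sgn_mu[OF y mu_row_nonzero[OF y] l]
      by (simp add: psi_def phi_def row_def column_def)
  qed
  show ?case
  proof (cases "l = j")
    case True
    have "sgn (A $ i $ j) \<noteq> 0"
      using step[of 0] am_v_Ch[OF v, of "Suc 0"] by (auto simp: Ch_def sgn_zero_iff)
    then have "sgn (A $ i $ j) * sgn (A $ i $ j) = 1" by (simp add: sgn_if split: if_splits)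
    then show ?thesis using step True by simp
  next
    case False
    then have "\<bar>row i A $ j\<bar> \<noteq> infnorm (row i A)"
      using unique_argmax_if_mu_nonzero[OF mu_row_nonzero _ l] by metis
    then have "\<bar>A $ i $ j\<bar> < infnorm (row i A)"
      using component_le_infnorm_cart[of "row i A" j] by (simp add: row_def)
    also have "\<dots> \<le> infnorm (column l A)"
      using l component_le_infnorm_cart[of "column l A" i] by (simp add: row_def column_def)
    finally have "infnorm (column j A) < infnorm (column l A)" using i by (simp add: column_def)
    then have "{k. infnorm (column l A) < infnorm (column k A)}
        \<subset> {k. infnorm (column j A) < infnorm (column k A)}"
      by auto
    then have "card {k. infnorm (column l A) < infnorm (column k A)}
        < card {k. infnorm (column j A) < infnorm (column k A)}"
      by (intro psubset_card_mono) auto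
    then have "\<forall>\<^sub>F k in sequentially. sgn (am_v A v (Suc k) $ l) = sgn (am_v A v k $ l)"
      by (rule less.IH)
    then have "\<forall>\<^sub>F k in sequentially. sgn (am_v A v (Suc (Suc k)) $ j) = sgn (am_v A v (Suc k) $ j)"
      by eventually_elim (simp only: step)
    then show ?thesis
      using eventually_sequentially_Suc[of "\<lambda>k. sgn (am_v A v (Suc k) $ j) = sgn (am_v A v k $ j)"]
      by simp
  qed
qed

lemma am_v_reaches_loop_signs:
  assumes v: "v \<in> Ch"
  obtains k where "sign_vec (am_v A v k) \<in> loop_vertices (sign_transition_graph A)"
proof -
  have "\<forall>\<^sub>F k in sequentially. \<forall>j. sgn (am_v A v (Suc k) $ j) = sgn (am_v A v k $ j)"
    by (intro eventually_all_finite am_v_sign_eventually_constant[OF v])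
  then obtain k where "\<forall>j. sgn (am_v A v (Suc k) $ j) = sgn (am_v A v k $ j)"
    unfolding eventually_sequentially by blast
  then have "sign_vec (am_v A v (Suc k)) = sign_vec (am_v A v k)"
    by (simp add: sign_vec_def vec_eq_iff del: am_v.simps)
  then have "sign_V A (sign_vec (am_v A v k)) = sign_vec (am_v A v k)"
    using sign_vec_am_v_Suc[OF v, of k] by simp
  then show ?thesis
    using v by (intro that[of k]) (auto simp: loop_vertices_eq intro: sign_vec_in_sign_vectors am_v_Ch)
qed

section \<open>Limit errors of the loop vertices\<close>

text \<open>The iterates, rescaled to norm one, have a limit point \<open>x\<close>. The bounds on \<open>mu\<close> keep its
  coordinates away from \<open>0\<close>, so that \<open>x\<close> has the signs of \<open>v\<close> and sweeps are continuous at \<open>x\<close>. The errors along the method started at \<open>x\<close> are then limits of a shifted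
  subsequence of the errors for \<open>v\<close>, hence all equal to \<open>limit_error A v\<close>.\<close>

lemma limit_error_optimal_in_loop_sign_class:
  assumes card: "CARD('m) \<ge> 2"
    and v: "v \<in> Ch" and loop: "sign_vec (psi A (phi A v)) = sign_vec v"
    and sw: "sign_vec w = sign_vec v" and su: "sign_vec u = sign_vec (phi A v)"
  shows "limit_error A v \<le> rank1_error A u w"
proof -
  have invariant: "sign_vec (am_v A x k) = sign_vec v" if "x \<in> Ch" "sign_vec x = sign_vec v" for x k
  proof (induction k)
    case (Suc k)
    have "sign_vec (am_v A x (Suc k)) = sign_V A (sign_vec v)"
      using sign_vec_am_v_Suc[OF that(1), of k] Suc.IH by simp
    then show ?case using sign_V_sign_vec[OF v] loop by simp
  qed (use that in simp)
  define y where "y = am_v A v"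
  have yCh: "y k \<in> Ch" for k using v by (simp add: y_def am_v_Ch)
  have sy: "sgn (y k $ j) = sgn (v $ j)" for k j
    using sign_vec_nth_eqD[OF invariant[OF v refl]] by (simp add: y_def)
  have ypos: "infnorm (y k) > 0" for k using yCh[of k] by (auto simp: Ch_def infnorm_pos_lt)
  \<comment> \<open>The bound below concerns ratios of coordinates produced by a sweep, hence the index \<open>Suc k\<close>.\<close>
  define z where "z = (\<lambda>k. (1 / infnorm (y (Suc k))) *\<^sub>R y (Suc k))"
  have zCh: "z k \<in> Ch" for k using ypos[of "Suc k"] yCh by (simp add: z_def Ch_scaleR)
  have "\<forall>j. \<exists>g>0. \<forall>u\<in>Ch. g \<le> \<bar>mu (column j A) u\<bar> * infnorm u"
    using mu_lower_bound[OF card mu_column_nonzero] by metis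
  then obtain g where g: "\<And>j. g j > 0" "\<And>j u. u \<in> Ch \<Longrightarrow> g j \<le> \<bar>mu (column j A) u\<bar> * infnorm u"
    by metis
  define M where "M = cheb_norm A"
  have M: "infnorm (column j A) \<le> M" for j
    using cheb_norm_le_iff[of A M] by (simp add: infnorm_le_cart_iff column_def M_def)
  have bound: "g j \<le> sgn (v $ j) * z k $ j * (2 * M)" for j k
  proof -
    let ?U = "phi A (y k)"
    have U: "?U \<in> Ch" using yCh by (rule phi_Ch)
    have y_eq: "y (Suc k) $ l = mu (column l A) ?U" for l by (simp add: y_def psi_def)
    obtain l where l: "\<bar>y (Suc k) $ l\<bar> = infnorm (y (Suc k))" by (rule infnorm_attained_cart)
    have "\<bar>z k $ j\<bar> * infnorm (y (Suc k)) = \<bar>y (Suc k) $ j\<bar>"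
      using ypos[of "Suc k"] by (simp add: z_def)
    then have "g j \<le> \<bar>z k $ j\<bar> * (infnorm (y (Suc k)) * infnorm ?U)"
      using g(2)[OF U, of j] by (simp add: y_eq flip: mult.assoc)
    also have "\<dots> \<le> \<bar>z k $ j\<bar> * (2 * M)"
      using mu_upper_bound[OF U, of "column l A"] M[of l] l
      by (intro mult_left_mono) (auto simp: y_eq)
    also have "\<bar>z k $ j\<bar> = sgn (v $ j) * z k $ j"
      using ypos[of "Suc k"] sy[of "Suc k" j] by (simp add: z_def abs_mult abs_sgn)
    finally show ?thesis .
  qed
  have "infnorm (z k) = 1" for k using ypos[of "Suc k"] by (simp add: z_def infnorm_mul)
  then have "bounded (range z)"
    using norm_le_infnorm[of "z _"] by (intro boundedI[of _ "sqrt DIM(real ^ 'n)"]) auto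
  then obtain x r where r: "strict_mono r" and x: "(z \<circ> r) \<longlonglongrightarrow> x"
    using bounded_imp_convergent_subsequence by blast
  have "(\<lambda>k. sgn (v $ j) * (z \<circ> r) k $ j * (2 * M)) \<longlonglongrightarrow> sgn (v $ j) * x $ j * (2 * M)" for j
    by (intro tendsto_mult tendsto_const tendsto_vec_nth x)
  then have "g j \<le> sgn (v $ j) * x $ j * (2 * M)" for j
    by (rule LIMSEQ_le_const) (use bound in auto)
  then have "0 < sgn (v $ j) * x $ j * (2 * M)" for j using g(1)[of j] by (meson less_le_trans)
  moreover have "M \<ge> 0" by (simp add: M_def cheb_norm_nonneg)
  ultimately have pos_x: "0 < sgn (v $ j) * x $ j" for j 
    by (auto simp: zero_less_mult_iff)
  have sx: "sgn (x $ j) = sgn (v $ j)" for j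
    using pos_x[of j] by (cases "v $ j" "0 :: real" rule: linorder_cases) auto
  have xCh: "x \<in> Ch" and sign_x: "sign_vec x = sign_vec v"
    using sx v by (auto simp: Ch_def sign_vec_def) (metis sgn_zero_iff)
  have stationary: "am_error A (am_v A x j) = limit_error A v" for j
  proof (rule LIMSEQ_unique)
    show "(\<lambda>k. am_error A (am_v A ((z \<circ> r) k) j)) \<longlonglongrightarrow> am_error A (am_v A x j)"
      using xCh zCh x by (intro tendsto_am_error tendsto_am_v am_v_Ch) (auto simp: comp_def)
    have "am_error A (am_v A ((z \<circ> r) k) j) = am_error A (am_v A v (Suc (r k) + j))" for k
      using ypos[of "Suc (r k)"] yCh[of "Suc (r k)"]
      by (simp add: z_def am_v_scaleR am_error_scaleR am_v_Ch am_v_add y_def del: am_v.simps add_Suc)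
    moreover have "strict_mono (\<lambda>k. Suc (r k) + j)" using r by (simp add: strict_mono_def)
    ultimately show "(\<lambda>k. am_error A (am_v A ((z \<circ> r) k) j)) \<longlonglongrightarrow> limit_error A v"
      using LIMSEQ_subseq_LIMSEQ[OF am_error_tendsto_limit_error[OF v]]
      by (simp add: comp_def del: am_v.simps)
  qed
  show ?thesis
  proof (rule stationary_error_optimal_in_sign_class[OF xCh stationary])
    show "sign_vec (am_v A x k) = sign_vec w" for k using invariant[OF xCh sign_x] sw by simp
    then show "sign_vec (phi A (am_v A x k)) = sign_vec u" for k
      unfolding su using xCh v sw by (intro sign_vec_phi_cong am_v_Ch) auto
  qed
qed

text \<open>The method is run from \<open>v\<close> until the signs form a loop vertex \<open>t\<close>. The iterate reached has error at
  most that of \<open>u\<close>, \<open>v\<close>, and the limit error of \<open>t\<close> is optimal among all pairs with these signs.\<close>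

lemma rank1_error_ge_limit_error_loop:
  assumes card: "CARD('m) \<ge> 2" and v: "v \<in> Ch"
  obtains t where "t \<in> loop_vertices (sign_transition_graph A)" "limit_error A t \<le> rank1_error A u v"
proof -
  obtain k where k: "sign_vec (am_v A v k) \<in> loop_vertices (sign_transition_graph A)"
    by (rule am_v_reaches_loop_signs[OF v])
  define y where "y = am_v A v k"
  define t where "t = sign_vec y"
  have y: "y \<in> Ch" using v by (simp add: y_def am_v_Ch)
  have t: "t \<in> Ch" "sign_vec t = t" using y by (auto simp: t_def intro: sign_vec_Ch)
  have "sign_vec (psi A (phi A t)) = sign_vec t"
    using k sign_V_sign_vec[OF t(1)] t(2) by (simp add: loop_vertices_eq t_def y_def)
  then have "limit_error A t \<le> rank1_error A (phi A y) y"
    using t y by (intro limit_error_optimal_in_loop_sign_class card sign_vec_phi_cong)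
      (auto simp: t_def)
  also have "\<dots> \<le> rank1_error A u v"
  proof -
    have "rank1_error A (phi A (am_v A v k)) (am_v A v k) \<le> rank1_error A (phi A v) v"
    proof (induction k)
      case (Suc k)
      have "am_error A (am_v A v k) \<le> rank1_error A (phi A (am_v A v k)) (am_v A v k)"
        unfolding am_error_def using v by (intro rank1_error_psi_le phi_Ch am_v_Ch)
      then show ?case using am_error_Suc_sandwich(2)[OF v, of k] Suc.IH by linarith
    qed simp
    then show ?thesis using rank1_error_phi_le[OF v, of A u] by (simp add: y_def)
  qed
  finally show ?thesis using k by (intro that[of t]) (auto simp: t_def y_def)
qed

end

lemma Ch_approximation:
  fixes v :: "real ^ 'n"
  obtains w where "\<And>k. w k \<in> Ch" "w \<longlonglongrightarrow> v"
proof -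
  define w :: "nat \<Rightarrow> real ^ 'n" where
    "w = (\<lambda>k. \<chi> i. if v $ i = 0 then 1 / real (Suc k) else v $ i)"
  have "(\<lambda>k. w k $ i) \<longlonglongrightarrow> v $ i" for i
    using LIMSEQ_inverse_real_of_nat by (cases "v $ i = 0") (auto simp: w_def inverse_eq_divide)
  then have "w \<longlonglongrightarrow> v" by (rule vec_tendstoI)
  moreover have "w k \<in> Ch" for k by (simp add: w_def Ch_def)
  ultimately show ?thesis using that by blast
qed

theorem theorem5p3:
  fixes A :: "real ^ 'n ^ 'm"
  assumes "CARD('m) \<ge> 2" and "CARD('n) \<ge> 2"
    and "preserves_chebyshev_systems A"
  defines "L \<equiv> loop_vertices (sign_transition_graph A)"
  shows "L \<noteq> {} \<and>
    Inf {cheb_norm (A - outer u v) | u v. True} = Min (limit_error A ` L)"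
proof -
  interpret chebyshev_preserving A by unfold_locales fact
  let ?S = "{cheb_norm (A - outer u v) | u v. True}"
  have L_sub: "L \<subseteq> sign_vectors" by (auto simp: L_def loop_vertices_eq)
  then have fin: "finite L" using finite_subset finite_sign_vectors by blast
  have "(\<chi> i. 1) \<in> (Ch :: (real ^ 'n) set)" by (simp add: Ch_def)
  then have ne: "L \<noteq> {}" using am_v_reaches_loop_signs unfolding L_def by blast
  have bdd: "bdd_below ?S" by (rule bdd_belowI[of _ 0]) (auto simp: cheb_norm_nonneg)
  have Min_le: "Min (limit_error A ` L) \<le> rank1_error A u v" for u v
  proof -
    obtain w where w: "\<And>k. w k \<in> Ch" "w \<longlonglongrightarrow> v"
      using Ch_approximation[of v] by blast
    have "Min (limit_error A ` L) \<le> rank1_error A u (w k)" for k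
    proof -
      obtain t where "t \<in> L" "limit_error A t \<le> rank1_error A u (w k)"
        using rank1_error_ge_limit_error_loop[OF assms(1) w(1)] unfolding L_def .
      then show ?thesis using fin by (meson Min_le finite_imageI image_eqI order_trans)
    qed
    then show ?thesis
      by (intro LIMSEQ_le_const[OF tendsto_rank1_error[OF tendsto_const w(2)]]) auto
  qed
  have "Inf ?S \<le> limit_error A t" if "t \<in> L" for t
  proof (rule LIMSEQ_le_const[OF am_error_tendsto_limit_error])
    show "t \<in> Ch" using that L_sub sign_vectors_subset_Ch by blast
    show "\<exists>N. \<forall>n\<ge>N. Inf ?S \<le> am_error A (am_v A t n)"
      using bdd by (auto simp: am_error_def rank1_error_def intro!: cInf_lower)
  qed
  then have "Inf ?S \<le> Min (limit_error A ` L)" using fin ne by simp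
  moreover have "Min (limit_error A ` L) \<le> Inf ?S"
    using Min_le by (intro cInf_greatest) (auto simp: rank1_error_def)
  ultimately show ?thesis using ne by (simp add: order_antisym)
qed

end
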